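(* Let $n$ be a positive integer and let $h:\mathbb{R}^n\to\mathbb{R}\cup\{\infty\}$ be a Legendre function. Then $\alpha(h)=1$ if and only if $h$ is a strictly convex quadratic function with $\operatorname{dom} h=\mathbb{R}^n$.
   Context: For $h:\mathbb{R}^n\to\mathbb{R}\cup\{\infty\}$, $\operatorname{dom} h := \{x\in\mathbb{R}^n \mid h(x)<\infty\}$. A proper convex function $h$ is essentially smooth if (i) $S:=\operatorname{int}(\operatorname{dom} h)$ is non-empty, (ii) $h$ is differentiable on $S$, and (iii) for every sequence $(x^{(i)})$ in $S$ converging to a point of the boundary of $S$, $\lim_{i\to\infty}\|\nabla h(x^{(i)})\|_2=\infty$. A function $h$ is a Legendre function if it is proper, closed (lower semicontinuous) and convex, strictly convex on $\operatorname{int}(\operatorname{dom} h)$, and essentially smooth. The Bregman distance is $D_h(x,y) := h(x)-h(y)-\langle\nabla h(y),x-y\rangle$ if $y\in\operatorname{int}(\operatorname{dom} h)$ and $D_h(x,y):=\infty$ otherwise. The symmetry coefficient of a Legendre function $h$ is $$\alpha(h) := \inf\left\{ \frac{D_h(x,y)}{D_h(y,x)} \;\middle|\; x,y\in\operatorname{int}(\operatorname{dom} h),\ x\neq y\right\}.$$ A strictly convex quadratic function with full domain is a function of the form $h(x)=\frac12\langle x,Qx\rangle+\langle b,x\rangle+c$ for all $x\in\mathbb{R}^n$, with $Q$ a symmetric positive definite $n\times n$ matrix, $b\in\mathbb{R}^n$ and $c\in\mathbb{R}$. *)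

theory Defs
  imports "HOL-Analysis.Analysis"
begin

text \<open>
  Functions with values in the reals extended by plus infinity are rendered as
  \<open>ereal\<close>-valued functions; the value \<open>-\<infinity>\<close> is excluded by \<open>proper_fun\<close>.
\<close>

definition edom :: "('a \<Rightarrow> ereal) \<Rightarrow> 'a set"
  where "edom h = {x. h x < \<infinity>}"

definition proper_fun :: "('a \<Rightarrow> ereal) \<Rightarrow> bool"
  where "proper_fun h \<longleftrightarrow> (\<forall>x. h x \<noteq> -\<infinity>) \<and> edom h \<noteq> {}"

text \<open>In \<open>ereal\<close>, \<open>0 * \<infinity> = 0\<close>, so the cases \<open>u = 0\<close> and \<open>v = 0\<close> hold trivially.\<close>

definition econvex :: "('a::real_vector \<Rightarrow> ereal) \<Rightarrow> bool"
  where "econvex h \<longleftrightarrow>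
    (\<forall>x y. \<forall>u\<ge>0. \<forall>v\<ge>0. u + v = 1 \<longrightarrow>
      h (u *\<^sub>R x + v *\<^sub>R y) \<le> ereal u * h x + ereal v * h y)"

definition strictly_econvex_on :: "'a::real_vector set \<Rightarrow> ('a \<Rightarrow> ereal) \<Rightarrow> bool"
  where "strictly_econvex_on S h \<longleftrightarrow>
    (\<forall>x\<in>S. \<forall>y\<in>S. \<forall>u>0. \<forall>v>0. x \<noteq> y \<longrightarrow> u + v = 1 \<longrightarrow>
      h (u *\<^sub>R x + v *\<^sub>R y) < ereal u * h x + ereal v * h y)"

definition lower_semicontinuous :: "('a::topological_space \<Rightarrow> ereal) \<Rightarrow> bool"
  where "lower_semicontinuous h \<longleftrightarrow> (\<forall>x. h x \<le> Liminf (at x) h)"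

text \<open>
  Differentiability and gradients of a proper \<open>h\<close> are only used on the open set
  \<open>interior (edom h)\<close>, where \<open>h\<close> is finite and agrees with \<open>real_of_ereal \<circ> h\<close>.
\<close>

definition grad :: "('a::real_inner \<Rightarrow> ereal) \<Rightarrow> 'a \<Rightarrow> 'a"
  where "grad h x = (THE D. GDERIV (\<lambda>z. real_of_ereal (h z)) x :> D)"

definition essentially_smooth :: "('a::real_inner \<Rightarrow> ereal) \<Rightarrow> bool"
  where "essentially_smooth h \<longleftrightarrow>
    proper_fun h \<and> econvex h \<and>
    interior (edom h) \<noteq> {} \<and>
    (\<forall>x\<in>interior (edom h). (\<lambda>z. real_of_ereal (h z)) differentiable (at x)) \<and>
    (\<forall>X p. (\<forall>i. X i \<in> interior (edom h)) \<longrightarrow> p \<in> frontier (interior (edom h)) \<longrightarrow>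
       X \<longlonglongrightarrow> p \<longrightarrow> filterlim (\<lambda>i. norm (grad h (X i))) at_top sequentially)"

definition legendre :: "('a::real_inner \<Rightarrow> ereal) \<Rightarrow> bool"
  where "legendre h \<longleftrightarrow>
    proper_fun h \<and> lower_semicontinuous h \<and> econvex h \<and>
    strictly_econvex_on (interior (edom h)) h \<and> essentially_smooth h"

definition bregman :: "('a::real_inner \<Rightarrow> ereal) \<Rightarrow> 'a \<Rightarrow> 'a \<Rightarrow> ereal"
  where "bregman h x y =
    (if y \<in> interior (edom h) then h x - h y - ereal (grad h y \<bullet> (x - y)) else \<infinity>)"

text \<open>
  For a Legendre \<open>h\<close> both Bregman distances below are finite and strictly positive,
  so the \<open>ereal\<close> quotient is the quotient of real numbers.
\<close>

definition symmetry_coeff :: "('a::real_inner \<Rightarrow> ereal) \<Rightarrow> ereal"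
  where "symmetry_coeff h =
    Inf {bregman h x y / bregman h y x | x y.
           x \<in> interior (edom h) \<and> y \<in> interior (edom h) \<and> x \<noteq> y}"

definition positive_definite :: "real ^ 'n ^ 'n \<Rightarrow> bool"
  where "positive_definite Q \<longleftrightarrow> (\<forall>x. x \<noteq> 0 \<longrightarrow> x \<bullet> (Q *v x) > 0)"

definition strictly_convex_quadratic :: "(real ^ 'n \<Rightarrow> ereal) \<Rightarrow> bool"
  where "strictly_convex_quadratic h \<longleftrightarrow>
    (\<exists>Q b c. transpose Q = Q \<and> positive_definite Q \<and>
      (\<forall>x. h x = ereal (1/2 * (x \<bullet> (Q *v x)) + b \<bullet> x + c)))"

end

theory Submission
  imports Defs
begin

text \<open>
  On \<open>S = interior (edom h)\<close> both Bregman distances are finite and positive, and swapping \<open>x\<close>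
  and \<open>y\<close> inverts their quotient. Hence \<open>symmetry_coeff h = 1\<close> says exactly that the Bregman
  distance is symmetric on \<open>S\<close>, that is, with \<open>f\<close> the real-valued \<open>h\<close> and \<open>G\<close> its gradient,
  \<open>2 (f x - f y) = (G x + G y) \<bullet> (x - y)\<close> for \<open>x, y \<in> S\<close>.

  This trapezoidal identity forces \<open>G\<close> to be affine without any second derivative of \<open>f\<close>. Solved
  for the terms in \<open>y\<close>, it says that \<open>2 f y + G y \<bullet> (x - y)\<close> is affine in \<open>y\<close> for each \<open>x\<close>;
  subtracting this for two choices of \<open>x\<close> removes \<open>f\<close> and leaves
  \<open>(G y - G z) \<bullet> (u - v) = (G u - G v) \<bullet> (y - z)\<close> on \<open>S\<close>
  (\<open>trapezoid_imp_selfadjoint\<close>). Since \<open>S\<close> is open, \<open>u - v\<close> reaches every direction, so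
  \<open>G x = G a + L (x - a)\<close> with a self-adjoint linear map \<open>L\<close>
  (\<open>selfadjoint_increments_imp_linear\<close>), and the trapezoidal identity itself turns this into a
  quadratic formula for \<open>f\<close>. Positivity of the Bregman distance makes \<open>L\<close> positive definite.

  Finally, an affine \<open>G\<close> stays bounded along convergent sequences, whereas essential smoothness
  asks for \<open>norm (G x) \<rightarrow> \<infinity>\<close> at the boundary of \<open>S\<close>. So \<open>S\<close> has no boundary and is the whole
  space.

  Conversely, the Bregman distance of a quadratic with matrix \<open>Q\<close> is
  \<open>1/2 (x - y) \<bullet> Q (x - y)\<close>, which is symmetric.
\<close>

section \<open>Gradients of convex functions\<close>

lemma differentiable_imp_GDERIV:
  fixes f :: "'a::euclidean_space \<Rightarrow> real"
  assumes "f differentiable (at x)"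
  shows "\<exists>D. GDERIV f x :> D"
proof -
  obtain f' where f': "(f has_derivative f') (at x)"
    using assms by (auto simp: differentiable_def)
  interpret f': bounded_linear f' using f' by (rule has_derivative_bounded_linear)
  have "f' v = v \<bullet> (\<Sum>b\<in>Basis. f' b *\<^sub>R b)" for v
  proof -
    have "f' v = f' (\<Sum>b\<in>Basis. (v \<bullet> b) *\<^sub>R b)" by (simp add: euclidean_representation)
    also have "\<dots> = (\<Sum>b\<in>Basis. (v \<bullet> b) * f' b)" by (simp add: f'.sum f'.scaleR)
    also have "\<dots> = v \<bullet> (\<Sum>b\<in>Basis. f' b *\<^sub>R b)"
      by (simp add: inner_sum_right mult.commute)
    finally show ?thesis .
  qed
  then have "f' = (\<lambda>v. v \<bullet> (\<Sum>b\<in>Basis. f' b *\<^sub>R b))" by blast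
  with f' show ?thesis unfolding gderiv_def by metis
qed

lemma GDERIV_unique:
  assumes "GDERIV f x :> D" "GDERIV f x :> E"
  shows "D = E"
proof -
  have "(\<lambda>v. v \<bullet> D) = (\<lambda>v. v \<bullet> E)"
    using assms unfolding gderiv_def by (rule has_derivative_unique)
  then have "(D - E) \<bullet> D = (D - E) \<bullet> E" by meson
  then have "(D - E) \<bullet> (D - E) = 0" by (simp add: inner_diff_right)
  then show ?thesis by simp
qed

lemma grad_eqI:
  assumes "GDERIV (\<lambda>z. real_of_ereal (h z)) x :> D"
  shows "grad h x = D"
  unfolding grad_def using assms by (blast intro: the_equality GDERIV_unique)

lemma GDERIV_grad:
  fixes h :: "'a::euclidean_space \<Rightarrow> ereal"
  assumes "(\<lambda>z. real_of_ereal (h z)) differentiable (at x)"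
  shows "GDERIV (\<lambda>z. real_of_ereal (h z)) x :> grad h x"
  using differentiable_imp_GDERIV[OF assms] grad_eqI by metis

lemma convex_on_above_gradient:
  fixes f :: "'a::real_inner \<Rightarrow> real"
  assumes f: "convex_on S f" and S: "open S" and D: "GDERIV f y :> D"
    and x: "x \<in> S" and y: "y \<in> S"
  shows "D \<bullet> (x - y) \<le> f x - f y"
proof -
  \<comment> \<open>Restrict \<open>f\<close> to the line through \<open>y\<close> and \<open>x\<close>; as \<open>S\<close> is open, the parameter \<open>0\<close> of \<open>y\<close> is
    an interior point of the parameter set, where the one-dimensional tangent inequality applies.\<close>
  define l where "l = (\<lambda>t. y + t *\<^sub>R (x - y))"
  define A where "A = l -` S"
  have l_comb: "l (u * s + v * t) = u *\<^sub>R l s + v *\<^sub>R l t" if "u + v = 1" for u v s t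
  proof -
    have "u *\<^sub>R l s + v *\<^sub>R l t = (u + v) *\<^sub>R y + (u * s + v * t) *\<^sub>R (x - y)"
      unfolding l_def by (simp only: scaleR_add_left scaleR_add_right scaleR_scaleR) (simp add: algebra_simps)
    then show ?thesis using that by (simp add: l_def)
  qed
  have convS: "convex S" using f by (simp add: convex_on_def)
  have convA: "convex A"
    unfolding convex_def A_def using l_comb convS by (auto simp: convex_def)
  have "convex_on A (f \<circ> l)"
    using f convA unfolding convex_on_def by (simp add: l_comb A_def)
  moreover have "open A"
    unfolding A_def l_def by (intro open_vimage S continuous_intros)
  moreover have "0 \<in> A" "1 \<in> A" using x y by (auto simp: A_def l_def)
  moreover have "((f \<circ> l) has_real_derivative (D \<bullet> (x - y))) (at 0 within A)"
  proof -
    have "(l has_derivative (\<lambda>t. t *\<^sub>R (x - y))) (at 0)"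
      unfolding l_def by (auto intro!: derivative_eq_intros)
    moreover have "(f has_derivative (\<lambda>v. v \<bullet> D)) (at (l 0))"
      using D by (simp add: gderiv_def l_def)
    ultimately have "((f \<circ> l) has_derivative ((\<lambda>v. v \<bullet> D) \<circ> (\<lambda>t. t *\<^sub>R (x - y)))) (at 0)"
      by (rule diff_chain_at)
    then have "((f \<circ> l) has_real_derivative (D \<bullet> (x - y))) (at 0)"
      unfolding has_field_derivative_def
      by (rule has_derivative_eq_rhs) (auto simp: inner_commute)
    then show ?thesis by (rule has_field_derivative_at_within)
  qed
  ultimately have "(f \<circ> l) 1 - (f \<circ> l) 0 \<ge> (D \<bullet> (x - y)) * (1 - 0)"
    by (intro convex_on_imp_above_tangent[of A])
       (auto simp: o_def interior_open convex_connected[OF convA])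
  then show ?thesis by (simp add: l_def)
qed

text \<open>
  Strictness at the midpoint alone is enough: the chord from \<open>y\<close> to the midpoint already lies
  above the tangent, and the chord from \<open>y\<close> to \<open>x\<close> is strictly steeper.
\<close>

lemma convex_on_strictly_above_gradient:
  fixes f :: "'a::real_inner \<Rightarrow> real"
  assumes f: "convex_on S f" and S: "open S" and D: "GDERIV f y :> D"
    and x: "x \<in> S" and y: "y \<in> S"
    and strict: "f ((1/2) *\<^sub>R x + (1/2) *\<^sub>R y) < 1/2 * f x + 1/2 * f y"
  shows "D \<bullet> (x - y) < f x - f y"
proof -
  define m where "m = (1/2) *\<^sub>R x + (1/2) *\<^sub>R y"
  have "m \<in> S"
    using f x y unfolding m_def convex_on_def by (auto intro: convexD)
  from convex_on_above_gradient[OF f S D this y] have "D \<bullet> (m - y) \<le> f m - f y" .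
  moreover have "m - y = (1/2) *\<^sub>R (x - y)"
    unfolding m_def by (simp add: algebra_simps flip: scaleR_add_left)
  ultimately show ?thesis using strict by (simp add: m_def[symmetric])
qed

section \<open>The trapezoidal identity\<close>

lemma trapezoid_imp_selfadjoint:
  fixes G :: "'a::real_inner \<Rightarrow> 'a"
  assumes trap: "\<And>x y. x \<in> S \<Longrightarrow> y \<in> S \<Longrightarrow> 2 * (f x - f y) = (G x + G y) \<bullet> (x - y)"
    and "u \<in> S" "v \<in> S" "y \<in> S" "z \<in> S"
  shows "(G y - G z) \<bullet> (u - v) = (G u - G v) \<bullet> (y - z)"
  \<comment> \<open>Around the cycle \<open>u, y, v, z\<close> the values of \<open>f\<close> telescope to zero.\<close>
  using trap[of u y] trap[of y v] trap[of v z] trap[of z u] assms(2-)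
  by (simp add: inner_diff_left inner_diff_right inner_add_left inner_add_right inner_commute)

lemma selfadjoint_increments_imp_linear:
  fixes G :: "'a::euclidean_space \<Rightarrow> 'a"
  assumes S: "open S" and a: "a \<in> S"
    and sa: "\<And>u y. u \<in> S \<Longrightarrow> y \<in> S \<Longrightarrow> (G y - G a) \<bullet> (u - a) = (G u - G a) \<bullet> (y - a)"
  obtains L where "linear L" "\<And>x. x \<in> S \<Longrightarrow> G x = G a + L (x - a)"
    "\<And>u v. L u \<bullet> v = u \<bullet> L v"
proof -
  obtain e where e: "e > 0" "cball a e \<subseteq> S"
    using S a open_contains_cball by blast
  have ab: "a + e *\<^sub>R b \<in> S" if "b \<in> Basis" for b
    using e that by (auto simp: dist_norm)
  \<comment> \<open>Testing the increment of \<open>G\<close> against the direction \<open>e b\<close> moves all dependence on the point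
    into an inner product with a fixed vector; this prescribes the \<open>b\<close>-component of \<open>L\<close>.\<close>
  define L where "L = (\<lambda>v. \<Sum>b\<in>Basis. (((G (a + e *\<^sub>R b) - G a) \<bullet> v) / e) *\<^sub>R b)"
  have lin: "linear L"
    unfolding L_def
    by (rule linearI) (simp_all add: inner_add_right add_divide_distrib scaleR_add_left sum.distrib
        scaleR_sum_right)
  have L_b: "L v \<bullet> b = ((G (a + e *\<^sub>R b) - G a) \<bullet> v) / e" if "b \<in> Basis" for v b
    using that by (simp add: L_def inner_sum_left inner_Basis if_distrib cong: if_cong)
  have GL: "G x = G a + L (x - a)" if "x \<in> S" for x
  proof -
    have "(G x - G a) \<bullet> b = L (x - a) \<bullet> b" if b: "b \<in> Basis" for b
      using sa[OF ab[OF b] \<open>x \<in> S\<close>] e by (simp add: L_b[OF b] field_simps)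
    then have "G x - G a = L (x - a)" by (rule euclidean_eqI)
    then show ?thesis by (simp add: algebra_simps)
  qed
  have adj: "L u \<bullet> v = u \<bullet> L v" for u v
  proof -
    \<comment> \<open>Both sides are bilinear, so it suffices to compare them on vectors short enough to stay
      in \<open>S\<close> when attached at \<open>a\<close>.\<close>
    define d where "d = e / (1 + norm u + norm v)"
    have pos: "1 + norm u + norm v > 0" using norm_ge_zero[of u] norm_ge_zero[of v] by linarith
    have d: "d > 0" using e pos by (simp add: d_def)
    have "norm (d *\<^sub>R w) \<le> e" if "norm w \<le> norm u + norm v" for w :: 'a
    proof -
      have "d * norm w \<le> d * (1 + norm u + norm v)"
        using d that by (intro mult_left_mono) auto
      also have "\<dots> = e" using pos by (simp add: d_def)
      finally show ?thesis using d by simp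
    qed
    then have "a + d *\<^sub>R u \<in> S" "a + d *\<^sub>R v \<in> S"
      using e by (auto simp: dist_norm subset_iff)
    from sa[OF this(2,1)] GL[OF this(1)] GL[OF this(2)]
    have "L (d *\<^sub>R u) \<bullet> (d *\<^sub>R v) = L (d *\<^sub>R v) \<bullet> (d *\<^sub>R u)" by simp
    then have "L u \<bullet> v = L v \<bullet> u" using d by (simp add: linear_scale[OF lin])
    then show ?thesis by (simp add: inner_commute)
  qed
  from that[OF lin GL adj] show thesis .
qed

section \<open>Bregman distances of Legendre functions\<close>

context
  fixes h :: "'a::euclidean_space \<Rightarrow> ereal"
  assumes h: "legendre h"
begin

private abbreviation (input) "S \<equiv> interior (edom h)"
private abbreviation (input) "f \<equiv> \<lambda>x. real_of_ereal (h x)"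

lemma legendre_finite:
  assumes "x \<in> edom h"
  shows "h x = ereal (f x)"
  using assms h by (cases "h x") (auto simp: legendre_def proper_fun_def edom_def)

lemma legendre_GDERIV: "x \<in> S \<Longrightarrow> GDERIV f x :> grad h x"
  using h by (auto simp: legendre_def essentially_smooth_def intro: GDERIV_grad)

lemma legendre_convex_on: "convex_on S f"
proof -
  have ec: "h (u *\<^sub>R x + v *\<^sub>R y) \<le> ereal u * h x + ereal v * h y"
    if "u \<ge> 0" "v \<ge> 0" "u + v = 1" for x y u v
    using h that by (auto simp: legendre_def econvex_def)
  have "convex (edom h)"
  proof (rule convexI)
    fix x y and u v :: real
    assume xy: "x \<in> edom h" "y \<in> edom h" and uv: "0 \<le> u" "0 \<le> v" "u + v = 1"
    have "h (u *\<^sub>R x + v *\<^sub>R y) \<le> ereal (u * f x + v * f y)"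
      using ec[OF uv, of x y] legendre_finite[OF xy(1)] legendre_finite[OF xy(2)]
      by (metis plus_ereal.simps(1) times_ereal.simps(1))
    also have "\<dots> < \<infinity>" by simp
    finally show "u *\<^sub>R x + v *\<^sub>R y \<in> edom h" by (simp add: edom_def)
  qed
  then have conv: "convex S" by (rule convex_interior)
  have "f (u *\<^sub>R x + v *\<^sub>R y) \<le> u * f x + v * f y"
    if xy: "x \<in> S" "y \<in> S" and uv: "0 \<le> u" "0 \<le> v" "u + v = 1" for x y u v
  proof -
    have "u *\<^sub>R x + v *\<^sub>R y \<in> S" using conv xy uv by (rule convexD)
    then have "ereal (f (u *\<^sub>R x + v *\<^sub>R y)) \<le> ereal u * ereal (f x) + ereal v * ereal (f y)"
      using ec[OF uv, of x y] xy interior_subset[of "edom h"] legendre_finite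
      by (metis subset_iff)
    then show ?thesis by simp
  qed
  with conv show ?thesis by (simp add: convex_on_def)
qed

lemma bregman_legendre:
  assumes "x \<in> S" "y \<in> S"
  shows "bregman h x y = ereal (f x - f y - grad h y \<bullet> (x - y))"
proof -
  have "x \<in> edom h" "y \<in> edom h" using assms interior_subset by blast+
  then obtain r s where "h x = ereal r" "h y = ereal s" by (blast dest: legendre_finite)
  then show ?thesis
    using assms(2) by (simp add: bregman_def)
qed

lemma bregman_legendre_pos:
  assumes xy: "x \<in> S" "y \<in> S" and "x \<noteq> y"
  shows "grad h y \<bullet> (x - y) < f x - f y"
proof (rule convex_on_strictly_above_gradient[OF legendre_convex_on open_interior
      legendre_GDERIV[OF xy(2)] xy])
  have "(1/2) *\<^sub>R x + (1/2) *\<^sub>R y \<in> S"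
    using legendre_convex_on xy by (intro convexD) (auto simp: convex_on_def)
  then have fin: "h x = ereal (f x)" "h y = ereal (f y)"
    "h ((1/2) *\<^sub>R x + (1/2) *\<^sub>R y) = ereal (f ((1/2) *\<^sub>R x + (1/2) *\<^sub>R y))"
    using xy interior_subset by (blast intro: legendre_finite)+
  have "\<forall>u>0. \<forall>v>0. x \<noteq> y \<longrightarrow> u + v = 1 \<longrightarrow>
      h (u *\<^sub>R x + v *\<^sub>R y) < ereal u * h x + ereal v * h y"
    using h xy by (simp add: legendre_def strictly_econvex_on_def)
  from this[rule_format, of "1/2" "1/2"] \<open>x \<noteq> y\<close>
  have "h ((1/2) *\<^sub>R x + (1/2) *\<^sub>R y) < ereal (1/2) * h x + ereal (1/2) * h y" by simp
  then have "ereal (f ((1/2) *\<^sub>R x + (1/2) *\<^sub>R y)) < ereal (1/2) * ereal (f x) + ereal (1/2) * ereal (f y)"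
    by (simp only: fin[symmetric])
  then show "f ((1/2) *\<^sub>R x + (1/2) *\<^sub>R y) < 1/2 * f x + 1/2 * f y"
    by simp
qed

lemma symmetry_coeff_1_imp_trapezoid:
  assumes "symmetry_coeff h = 1" and "x \<in> S" "y \<in> S"
  shows "2 * (f x - f y) = (grad h x + grad h y) \<bullet> (x - y)"
proof (cases "x = y")
  case False
  define d where "d = (\<lambda>p q. f p - f q - grad h q \<bullet> (p - q))"
  have d_pos: "d p q > 0" if "p \<in> S" "q \<in> S" "p \<noteq> q" for p q
    using bregman_legendre_pos[OF that] by (simp only: d_def diff_gt_0_iff_gt)
  have le: "d q p \<le> d p q" if pq: "p \<in> S" "q \<in> S" "p \<noteq> q" for p q
  proof -
    have "symmetry_coeff h \<le> bregman h p q / bregman h q p"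
      unfolding symmetry_coeff_def by (rule Inf_lower) (use pq in blast)
    then have "1 \<le> ereal (d p q) / ereal (d q p)"
      by (simp only: assms(1) bregman_legendre[OF pq(1,2)] bregman_legendre[OF pq(2,1)] d_def)
    then have "1 \<le> d p q / d q p"
      using d_pos[OF pq(2,1)] pq(3) by (simp add: one_ereal_def)
    then show ?thesis
      using d_pos[OF pq(2,1)] pq(3) by (simp add: pos_le_divide_eq)
  qed
  have "d x y = d y x"
    using le[OF assms(2,3)] le[OF assms(3,2)] False by force
  then have "f x - f y - grad h y \<bullet> (x - y) = f y - f x - grad h x \<bullet> (y - x)"
    by (simp only: d_def)
  moreover have "grad h x \<bullet> (y - x) = - (grad h x \<bullet> (x - y))"
    by (simp add: inner_diff_right)
  moreover have "2 * (p - q) = s + t" if "p - q - t = q - p - r" "r = - s" for p q r s t :: real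
    using that by simp
  ultimately show ?thesis
    unfolding inner_add_left by blast
qed simp

text \<open>
  A symmetric Bregman distance leaves no room for a boundary of the domain: the gradient is affine,
  so it cannot blow up at a finite point.
\<close>

lemma symmetry_coeff_1_imp_quadratic:
  assumes sym: "symmetry_coeff h = 1"
  obtains L b c where "linear L" "\<And>u v. L u \<bullet> v = u \<bullet> L v" "\<And>v. v \<noteq> 0 \<Longrightarrow> v \<bullet> L v > 0"
    "edom h = UNIV" "\<And>x. h x = ereal (1/2 * (x \<bullet> L x) + b \<bullet> x + c)"
proof -
  let ?G = "grad h"
  note trap = symmetry_coeff_1_imp_trapezoid[OF sym]
  obtain a where a: "a \<in> S" using h by (auto simp: legendre_def essentially_smooth_def)
  have sa: "(?G y - ?G a) \<bullet> (u - a) = (?G u - ?G a) \<bullet> (y - a)" if "u \<in> S" "y \<in> S" for u y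
    by (rule trapezoid_imp_selfadjoint[of S f ?G]) (use trap that a in auto)
  obtain L where lin: "linear L" and GL: "\<And>x. x \<in> S \<Longrightarrow> ?G x = ?G a + L (x - a)"
    and adj: "\<And>u v. L u \<bullet> v = u \<bullet> L v"
    using selfadjoint_increments_imp_linear[OF open_interior a sa] by blast
  have "frontier S = {}"
  proof (rule ccontr)
    assume "frontier S \<noteq> {}"
    then obtain p where p: "p \<in> frontier S" by blast
    then have "p \<in> closure S" by (simp add: frontier_def)
    then obtain X where X: "\<And>i. X i \<in> S" "X \<longlonglongrightarrow> p"
      by (auto simp: closure_sequential)
    have "filterlim (\<lambda>i. norm (?G (X i))) at_top sequentially"
      using h X p by (auto simp: legendre_def essentially_smooth_def)
    then have "filterlim (\<lambda>i. ?G (X i)) at_infinity sequentially"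
      by (rule filterlim_norm_at_top_imp_at_infinity)
    moreover have "(\<lambda>i. ?G a + L (X i - a)) \<longlonglongrightarrow> ?G a + L (p - a)"
      using lin X(2) unfolding linear_conv_bounded_linear
      by (intro tendsto_add tendsto_const bounded_linear.tendsto[of L] tendsto_diff)
    then have "(\<lambda>i. ?G (X i)) \<longlonglongrightarrow> ?G a + L (p - a)"
      using GL[OF X(1)] by simp
    ultimately show False
      using not_tendsto_and_filterlim_at_infinity[OF sequentially_bot] by blast
  qed
  then have univ: "S = UNIV" using a by (auto simp: frontier_eq_empty)
  then have dom: "edom h = UNIV" using interior_subset by blast
  have f_a: "f x = f a + ?G a \<bullet> (x - a) + 1/2 * ((x - a) \<bullet> L (x - a))" for x
    using trap[of x a] GL[of x] univ by (simp add: inner_add_left inner_add_right inner_commute)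
  have pos: "v \<bullet> L v > 0" if "v \<noteq> 0" for v
    using bregman_legendre_pos[of "a + v" a] f_a[of "a + v"] univ that by simp
  have "h x = ereal (1/2 * (x \<bullet> L x) + (?G a - L a) \<bullet> x + (f a - ?G a \<bullet> a + 1/2 * (a \<bullet> L a)))" for x
  proof -
    have "a \<bullet> L x = x \<bullet> L a" using adj[of a x] by (metis inner_commute)
    then have eq: "f x = 1/2 * (x \<bullet> L x) + (?G a - L a) \<bullet> x + (f a - ?G a \<bullet> a + 1/2 * (a \<bullet> L a))"
      unfolding f_a[of x] linear_diff[OF lin]
      by (simp add: inner_diff_left inner_diff_right inner_commute[of "L a" x])
    show ?thesis
      by (rule trans[OF legendre_finite arg_cong[of _ _ ereal, OF eq]]) (simp add: dom)
  qed
  from that[OF lin adj pos dom this] show thesis .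
qed

end

section \<open>Bregman distances of quadratic functions\<close>

lemma inner_symmetric_matrix:
  fixes Q :: "real ^ 'n ^ 'n"
  assumes "transpose Q = Q"
  shows "y \<bullet> (Q *v x) = x \<bullet> (Q *v y)"
proof -
  have "y \<bullet> (Q *v x) = (transpose Q *v y) \<bullet> x"
    by (simp only: transpose_matrix_vector dot_lmul_matrix)
  then show ?thesis by (simp only: assms inner_commute)
qed

lemma GDERIV_quadratic:
  fixes Q :: "real ^ 'n ^ 'n"
  assumes "transpose Q = Q"
  shows "GDERIV (\<lambda>x. 1/2 * (x \<bullet> (Q *v x)) + b \<bullet> x + c) y :> Q *v y + b"
proof -
  have lin: "((\<lambda>x. Q *v x) has_derivative (\<lambda>v. Q *v v)) (at y)"
    by (intro bounded_linear.has_derivative[OF matrix_vector_mul_bounded_linear] has_derivative_ident)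
  have "((\<lambda>x. x \<bullet> (Q *v x)) has_derivative (\<lambda>v. y \<bullet> (Q *v v) + v \<bullet> (Q *v y))) (at y)"
    by (rule has_derivative_inner[OF has_derivative_ident lin])
  then have "((\<lambda>x. 1/2 * (x \<bullet> (Q *v x)) + b \<bullet> x + c) has_derivative
      (\<lambda>v. 1/2 * (y \<bullet> (Q *v v) + v \<bullet> (Q *v y)) + b \<bullet> v)) (at y)"
    by (intro has_derivative_add_const has_derivative_add has_derivative_mult_right
        has_derivative_inner_right has_derivative_ident)
  moreover have "(\<lambda>v. 1/2 * (y \<bullet> (Q *v v) + v \<bullet> (Q *v y)) + b \<bullet> v) = (\<lambda>v. v \<bullet> (Q *v y + b))"
    by (simp add: inner_symmetric_matrix[OF assms, of y] inner_add_right inner_commute[of b])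
  ultimately show ?thesis unfolding gderiv_def by (simp only:)
qed

lemma bregman_quadratic:
  fixes h :: "real ^ 'n \<Rightarrow> ereal"
  assumes Q: "transpose Q = Q" and h: "\<And>x. h x = ereal (1/2 * (x \<bullet> (Q *v x)) + b \<bullet> x + c)"
  shows "bregman h x y = ereal (1/2 * ((x - y) \<bullet> (Q *v (x - y))))"
proof -
  have "grad h y = Q *v y + b"
    by (rule grad_eqI) (simp only: h real_of_ereal.simps GDERIV_quadratic[OF Q])
  moreover have "edom h = UNIV" by (simp add: edom_def h)
  moreover have swap: "y \<bullet> (Q *v x) = x \<bullet> (Q *v y)"
    by (rule inner_symmetric_matrix[OF Q])
  ultimately have "bregman h x y = ereal (1/2 * (x \<bullet> (Q *v x)) + b \<bullet> x + c
      - (1/2 * (y \<bullet> (Q *v y)) + b \<bullet> y + c) - (Q *v y + b) \<bullet> (x - y))"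
    by (simp add: bregman_def h)
  also have "(Q *v y + b) \<bullet> (x - y) = x \<bullet> (Q *v y) + b \<bullet> x - y \<bullet> (Q *v y) - b \<bullet> y"
    by (simp add: inner_add_left inner_diff_right inner_commute[of "Q *v y"])
  also have "1/2 * (x \<bullet> (Q *v x)) + b \<bullet> x + c - (1/2 * (y \<bullet> (Q *v y)) + b \<bullet> y + c)
      - (x \<bullet> (Q *v y) + b \<bullet> x - y \<bullet> (Q *v y) - b \<bullet> y)
    = 1/2 * ((x - y) \<bullet> (Q *v (x - y)))"
    by (simp add: matrix_vector_mult_diff_distrib inner_diff_left inner_diff_right swap)
  finally show ?thesis .
qed

lemma symmetry_coeff_quadratic:
  fixes h :: "real ^ 'n \<Rightarrow> ereal"
  assumes "strictly_convex_quadratic h"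
  shows "symmetry_coeff h = 1"
proof -
  obtain Q b c where Q: "transpose Q = Q" "positive_definite Q"
    and h: "\<And>x. h x = ereal (1/2 * (x \<bullet> (Q *v x)) + b \<bullet> x + c)"
    using assms unfolding strictly_convex_quadratic_def by blast
  have one: "bregman h x y / bregman h y x = 1" if "x \<noteq> y" for x y
  proof -
    have "(x - y) \<bullet> (Q *v (x - y)) > 0" "(y - x) \<bullet> (Q *v (y - x)) > 0"
      using Q(2) that by (auto simp: positive_definite_def)
    moreover have "(y - x) \<bullet> (Q *v (y - x)) = (x - y) \<bullet> (Q *v (x - y))"
      by (simp add: matrix_vector_mult_diff_distrib inner_diff_left inner_diff_right)
    ultimately show ?thesis by (simp add: bregman_quadratic[OF Q(1) h] one_ereal_def)
  qed
  let ?R = "{bregman h x y / bregman h y x | x y.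
           x \<in> interior (edom h) \<and> y \<in> interior (edom h) \<and> x \<noteq> y}"
  have univ: "interior (edom h) = UNIV" by (simp add: edom_def h)
  \<comment> \<open>The infimum is taken over a nonempty set because the space has a nonzero vector.\<close>
  have ne: "(axis undefined 1 :: real ^ 'n) \<noteq> 0" by simp
  have "?R \<subseteq> {1}" using one by blast
  moreover have "1 \<in> ?R" unfolding univ using one[OF ne, symmetric] ne by blast
  ultimately have "?R = {1}" by blast
  then show ?thesis by (simp add: symmetry_coeff_def)
qed

section \<open>The characterisation\<close>

theorem proposition3p3:
  fixes h :: "real ^ 'n \<Rightarrow> ereal"
  assumes "legendre h"
  shows "symmetry_coeff h = 1 \<longleftrightarrow> strictly_convex_quadratic h \<and> edom h = UNIV"
proof
  assume "symmetry_coeff h = 1"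
  then obtain L b c where L: "linear L" "\<And>u v. L u \<bullet> v = u \<bullet> L v" "\<And>v. v \<noteq> 0 \<Longrightarrow> v \<bullet> L v > 0"
    and dom: "edom h = UNIV" and h: "\<And>x. h x = ereal (1/2 * (x \<bullet> L x) + b \<bullet> x + c)"
    using symmetry_coeff_1_imp_quadratic[OF assms] by blast
  have mat: "matrix L *v x = L x" for x using L(1) by (simp add: matrix_works)
  have "transpose (matrix L) = matrix L"
    using matrix_adjoint[OF L(1)] adjoint_unique[of L L] L(2) by simp
  moreover have "positive_definite (matrix L)" using L(3) by (simp add: positive_definite_def mat)
  ultimately have "strictly_convex_quadratic h"
    unfolding strictly_convex_quadratic_def
    by (intro exI[of _ "matrix L"] exI[of _ b] exI[of _ c]) (simp add: h mat)
  with dom show "strictly_convex_quadratic h \<and> edom h = UNIV" by simp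
next
  assume "strictly_convex_quadratic h \<and> edom h = UNIV"
  then show "symmetry_coeff h = 1" by (simp add: symmetry_coeff_quadratic)
qed

end
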